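(* Let $C\subset\mathbb{R}^n$ be a non-empty closed set, let $f:C\to\mathbb{R}$ be Lipschitz continuous on $C$ with constant $L$, and let $M\ge L$, $M>0$. Define $$\Phi(x)=\inf_{y\in C}\bigl(f(y)+M\,\|x-y\|\bigr),\qquad x\in\mathbb{R}^n .$$ Then the global minimum points of $f$ on $C$ coincide with the global minimum points of $\Phi$ on $\mathbb{R}^n$.
   Context: $\|\cdot\|$ is the Euclidean norm on $\mathbb{R}^n$. $f$ is Lipschitz with constant $L$ on $C$ if $|f(x_1)-f(x_2)|\le L\|x_1-x_2\|$ for all $x_1,x_2\in C$. *)

theory Defs
  imports "HOL-Analysis.Analysis"
begin

(* Inf on the reals is unspecified for sets that are not bounded below.  If C is non-empty, f is
   Lipschitz on C with constant L <= M and M >= 0, then for any fixed c in C every value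
   f y + M * norm (x - y) with y in C is at least f c - M * norm (x - c), so this is the true infimum. *)
definition lipschitz_extension ::
    "real \<Rightarrow> (real ^ 'n) set \<Rightarrow> (real ^ 'n \<Rightarrow> real) \<Rightarrow> real ^ 'n \<Rightarrow> real" where
  "lipschitz_extension M C f x = (INF y\<in>C. f y + M * norm (x - y))"

end

theory Submission
  imports Defs
begin

text \<open>
  Write \<open>\<Phi>\<close> for the extension. It agrees with \<open>f\<close> on \<open>C\<close>, because the Lipschitz bound gives
  \<open>f x \<le> f y + M * norm (x - y)\<close> for \<open>x, y \<in> C\<close>, with equality at \<open>y = x\<close>.
  A lower bound of \<open>f\<close> on \<open>C\<close> is a lower bound of \<open>\<Phi>\<close> everywhere, so minimum points of \<open>f\<close> on \<open>C\<close>
  are minimum points of \<open>\<Phi>\<close>. Conversely, \<open>\<Phi>\<close> has no minimum point outside \<open>C\<close>: the penalty term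
  gives \<open>\<Phi> x \<ge> m + M * d\<close> whenever \<open>m\<close> is a lower bound of \<open>f\<close> on \<open>C\<close> and \<open>d\<close> is the distance
  from \<open>x\<close> to \<open>C\<close>, and if \<open>x\<close> minimizes \<open>\<Phi>\<close> then \<open>m = \<Phi> x\<close> is such a lower bound,
  which forces \<open>d = 0\<close>, that is, \<open>x \<in> C\<close> since \<open>C\<close> is closed.
\<close>

lemma lipschitz_extension_ge:
  assumes "C \<noteq> {}" and "\<And>y. y \<in> C \<Longrightarrow> m \<le> f y" and "M \<ge> 0"
  shows "m + M * infdist x C \<le> lipschitz_extension M C f x"
  unfolding lipschitz_extension_def
proof (rule cINF_greatest[OF assms(1)])
  fix y assume "y \<in> C"
  then have "infdist x C \<le> norm (x - y)"
    by (metis infdist_le dist_norm)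
  then show "m + M * infdist x C \<le> f y + M * norm (x - y)"
    using assms(2)[OF \<open>y \<in> C\<close>] assms(3) by (intro add_mono mult_left_mono)
qed

lemma lipschitz_extension_eq:
  assumes lip: "\<And>a b. a \<in> C \<Longrightarrow> b \<in> C \<Longrightarrow> \<bar>f a - f b\<bar> \<le> M * norm (a - b)"
    and "x \<in> C"
  shows "lipschitz_extension M C f x = f x"
  unfolding lipschitz_extension_def
proof (rule cInf_eq_minimum)
  show "f x \<in> (\<lambda>y. f y + M * norm (x - y)) ` C"
    using \<open>x \<in> C\<close> by (intro image_eqI[of _ _ x]) simp_all
next
  fix z assume "z \<in> (\<lambda>y. f y + M * norm (x - y)) ` C"
  then obtain y where "y \<in> C" "z = f y + M * norm (x - y)"
    by blast
  then show "f x \<le> z"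
    using lip[OF \<open>x \<in> C\<close> \<open>y \<in> C\<close>] by linarith
qed

theorem theorem6:
  fixes C :: "(real ^ 'n) set" and f :: "real ^ 'n \<Rightarrow> real" and L M :: real
  assumes "C \<noteq> {}"
    and "closed C"
    and "\<And>x1 x2. x1 \<in> C \<Longrightarrow> x2 \<in> C \<Longrightarrow> \<bar>f x1 - f x2\<bar> \<le> L * norm (x1 - x2)"
    and "M \<ge> L"
    and "M > 0"
  shows "{x. is_arg_min f (\<lambda>x. x \<in> C) x} =
         {x. is_arg_min (lipschitz_extension M C f) (\<lambda>x. x \<in> UNIV) x}"
proof -
  let ?\<Phi> = "lipschitz_extension M C f"
  have "\<bar>f a - f b\<bar> \<le> M * norm (a - b)" if "a \<in> C" "b \<in> C" for a b
    using assms(3)[OF that] mult_right_mono[OF \<open>M \<ge> L\<close>, of "norm (a - b)"] by simp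
  then have ext: "?\<Phi> x = f x" if "x \<in> C" for x
    using that by (intro lipschitz_extension_eq)
  have below: "m + M * infdist x C \<le> ?\<Phi> x" if "\<And>y. y \<in> C \<Longrightarrow> m \<le> f y" for m x
    using assms(1,5) that by (intro lipschitz_extension_ge) simp_all
  have "is_arg_min f (\<lambda>x. x \<in> C) x \<longleftrightarrow> is_arg_min ?\<Phi> (\<lambda>x. x \<in> UNIV) x" for x
  proof
    assume "is_arg_min f (\<lambda>x. x \<in> C) x"
    then have "x \<in> C" and min: "\<And>y. y \<in> C \<Longrightarrow> f x \<le> f y"
      by (auto simp: is_arg_min_linorder)
    have "?\<Phi> x \<le> ?\<Phi> z" for z
    proof -
      have "0 \<le> M * infdist z C"
        using \<open>M > 0\<close> infdist_nonneg[of z C] by simp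
      then show ?thesis
        using below[OF min, of z] ext[OF \<open>x \<in> C\<close>] by linarith
    qed
    then show "is_arg_min ?\<Phi> (\<lambda>x. x \<in> UNIV) x"
      by (simp add: is_arg_min_linorder)
  next
    assume "is_arg_min ?\<Phi> (\<lambda>x. x \<in> UNIV) x"
    then have "?\<Phi> x \<le> ?\<Phi> y" for y
      by (simp add: is_arg_min_linorder)
    then have min: "?\<Phi> x \<le> f y" if "y \<in> C" for y
      using ext[OF that] by metis
    have "M * infdist x C \<le> 0"
      using below[OF min, of x] by simp
    then have "infdist x C = 0"
      using \<open>M > 0\<close> infdist_nonneg[of x C] by (simp add: mult_le_0_iff)
    then have "x \<in> C"
      using in_closed_iff_infdist_zero[OF assms(2,1)] by blast
    then show "is_arg_min f (\<lambda>x. x \<in> C) x"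
      using min ext by (simp add: is_arg_min_linorder)
  qed
  then show ?thesis
    by simp
qed

end
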